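(* Let $m\ge 1$ and $n>m+1$ be integers. Let $f_0,\ldots,f_m:\mathbb{R}^n\to\mathbb{R}$ be quadratic forms such that $f_0$ is positive definite and such that there exists a linear form $\ell:\mathbb{R}^n\to\mathbb{R}$ with the property that for every $1\le i\le m$ one has $f_i(x)=\ell(x)\ell_i(x)$ for some linear form $\ell_i:\mathbb{R}^n\to\mathbb{R}$. Then the quadratic map $\varphi=(f_0,\ldots,f_m):\mathbb{R}^n\to\mathbb{R}^{m+1}$ satisfies hidden hyperplane convexity.
   Context: A quadratic map $\varphi:\mathbb{R}^n\to\mathbb{R}^k$ is a map each of whose components is a quadratic form $x\mapsto x^\top Q_i x$ with $Q_i$ symmetric. A linear hyperplane of $\mathbb{R}^n$ is a linear subspace of dimension $n-1$. The quadratic map $\varphi$ satisfies hidden hyperplane convexity (HHC) if for every linear hyperplane $H\subseteq\mathbb{R}^n$ the set $\{\varphi(x):x\in H\}\subseteq\mathbb{R}^k$ is convex. *)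

theory Defs
  imports "HOL-Analysis.Analysis"
begin

definition quadratic_form :: "(real ^ 'n \<Rightarrow> real) \<Rightarrow> bool" where
  "quadratic_form f \<longleftrightarrow>
     (\<exists>Q :: real ^ 'n ^ 'n. transpose Q = Q \<and> (\<forall>x. f x = x \<bullet> (Q *v x)))"

definition positive_definite :: "(real ^ 'n \<Rightarrow> real) \<Rightarrow> bool" where
  "positive_definite f \<longleftrightarrow> (\<forall>x. x \<noteq> 0 \<longrightarrow> f x > 0)"

definition quadratic_map :: "(real ^ 'n \<Rightarrow> real ^ 'k) \<Rightarrow> bool" where
  "quadratic_map \<phi> \<longleftrightarrow> (\<forall>j. quadratic_form (\<lambda>x. \<phi> x $ j))"

definition linear_hyperplane :: "(real ^ 'n) set \<Rightarrow> bool" where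
  "linear_hyperplane H \<longleftrightarrow> subspace H \<and> dim H = CARD('n) - 1"

definition hidden_hyperplane_convex :: "(real ^ 'n \<Rightarrow> real ^ 'k) \<Rightarrow> bool" where
  "hidden_hyperplane_convex \<phi> \<longleftrightarrow>
     quadratic_map \<phi> \<and> (\<forall>H. linear_hyperplane H \<longrightarrow> convex (\<phi> ` H))"

end

theory Submission imports Defs "HOL-Real_Asymp.Real_Asymp" begin

text \<open>
  Fix a hyperplane \<open>H\<close> and write \<open>f\<^sub>i = l L\<^sub>i\<close> for \<open>i \<ge> 1\<close>. Given \<open>x, y \<in> H\<close> and weights
  \<open>u + v = 1\<close>, a preimage in \<open>H\<close> of \<open>u \<phi>(x) + v \<phi>(y)\<close> is found in two steps.

  If \<open>u l(x)\<close> and \<open>v l(y)\<close> are not both zero, put \<open>s\<^sup>2 = u l(x)\<^sup>2 + v l(y)\<^sup>2\<close> and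
  \<open>z = (u l(x) x + v l(y) y) / s\<close>. By linearity \<open>l(z) = s\<close> and
  \<open>L\<^sub>i(z) = (u f\<^sub>i(x) + v f\<^sub>i(y)) / s\<close>, so \<open>z\<close> has the desired values of \<open>f\<^sub>1, \<dots>, f\<^sub>m\<close>, and the
  Cauchy--Schwarz inequality for \<open>f\<^sub>0\<close> says that \<open>f\<^sub>0(z)\<close> is at most the desired value
  (\<open>exists_below_convex_combination\<close>).

  It remains to raise \<open>f\<^sub>0\<close> while the products \<open>l L\<^sub>i\<close> stay fixed (\<open>raise_definite_form\<close>). Since
  \<open>dim H = n - 1 > m\<close>, there is a nonzero \<open>w \<in> H\<close> on which every \<open>L\<^sub>i\<close> vanishes. If \<open>l(w) = 0\<close>, moving
  along the line \<open>z + t w\<close> changes none of the products. Otherwise \<open>z = p + q\<close> with \<open>p\<close>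
  proportional to \<open>w\<close> and \<open>l(q) = 0\<close>, and on the hyperbola \<open>t p + q / t\<close> the form \<open>l\<close> is multiplied
  by \<open>t\<close> and each \<open>L\<^sub>i\<close> by \<open>1 / t\<close>. In both cases \<open>f\<^sub>0\<close> tends to infinity along the curve, and the
  intermediate value theorem applies.

  If \<open>u l(x) = v l(y) = 0\<close>, the values of \<open>f\<^sub>1, \<dots>, f\<^sub>m\<close> to be hit are zero, and a multiple of a nonzero vector of
  \<open>H \<inter> ker l\<close>, which exists since \<open>dim H \<ge> 2\<close>, gives \<open>f\<^sub>0\<close> the desired value.
\<close>

section \<open>Common zeros of linear functionals on a subspace\<close>

text \<open>
  On \<open>S\<close> a functional is the inner product with a vector of \<open>S\<close>, namely the orthogonal projection
  of its representing vector; fewer than \<open>dim S\<close> such vectors span a proper subspace of \<open>S\<close>.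
\<close>

lemma common_zero_of_functionals:
  fixes L :: "'i \<Rightarrow> 'a::euclidean_space \<Rightarrow> real"
  assumes S: "subspace S" and I: "finite I" "card I < dim S"
    and L: "\<And>i. i \<in> I \<Longrightarrow> linear (L i)"
  obtains w where "w \<in> S" "w \<noteq> 0" "\<And>i. i \<in> I \<Longrightarrow> L i w = 0"
proof -
  have "\<exists>a\<in>S. \<forall>x\<in>S. L i x = a \<bullet> x" if i: "i \<in> I" for i
  proof -
    define c where "c = adjoint (L i) 1"
    have c: "L i x = c \<bullet> x" for x
      using adjoint_works[OF L[OF i], of x 1] by (simp add: c_def inner_commute)
    obtain a b where ab: "a \<in> span S" "\<And>w. w \<in> span S \<Longrightarrow> orthogonal b w" "c = a + b"
      using orthogonal_subspace_decomp_exists[of S c] by metis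
    have "a \<in> S" using ab S by (simp add: span_eq_iff[THEN iffD2])
    moreover have "L i x = a \<bullet> x" if "x \<in> S" for x
      using ab(2)[of x] ab(3) c[of x] that by (simp add: orthogonal_def inner_add_left span_base)
    ultimately show ?thesis by blast
  qed
  then obtain a where a: "\<And>i. i \<in> I \<Longrightarrow> a i \<in> S"
      "\<And>i x. i \<in> I \<Longrightarrow> x \<in> S \<Longrightarrow> L i x = a i \<bullet> x"
    by metis
  have "dim (a ` I) \<le> card I"
    using dim_le_card'[of "a ` I"] card_image_le[OF I(1), of a] I(1) by simp
  then have "dim (a ` I) \<noteq> dim S" using I(2) by simp
  then have "span (a ` I) \<noteq> span S" by (metis dim_span)
  moreover have "span (a ` I) \<subseteq> span S" using a(1) by (intro span_mono) auto
  ultimately obtain w where w: "w \<noteq> 0" "w \<in> span S"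
      "\<And>y. y \<in> span (a ` I) \<Longrightarrow> orthogonal w y"
    using orthogonal_to_subspace_exists_gen[of "a ` I" S] by blast
  have wS: "w \<in> S" using w(2) S by (simp add: span_eq_iff[THEN iffD2])
  moreover have "L i w = 0" if "i \<in> I" for i
    using w(3)[of "a i"] a(2)[OF that wS] that
    by (simp add: span_base orthogonal_def inner_commute)
  ultimately show ?thesis using that w(1) by blast
qed

section \<open>Values of a definite form along curves\<close>

lemma quadratic_form_combination:
  assumes "quadratic_form f"
  obtains b where "\<And>s t. f (s *\<^sub>R x + t *\<^sub>R y) = s\<^sup>2 * f x + 2 * s * t * b + t\<^sup>2 * f y"
proof -
  obtain Q where Q: "transpose Q = Q" "\<And>x. f x = x \<bullet> (Q *v x)"
    using assms unfolding quadratic_form_def by blast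
  have sym: "y \<bullet> (Q *v x) = x \<bullet> (Q *v y)"
    by (metis Q(1) dot_lmul_matrix inner_commute transpose_matrix_vector)
  have "f (s *\<^sub>R x + t *\<^sub>R y) = s\<^sup>2 * f x + 2 * s * t * (x \<bullet> (Q *v y)) + t\<^sup>2 * f y" for s t
    by (simp add: Q(2) matrix_vector_right_distrib matrix_vector_mult_scaleR inner_add_left
        inner_add_right sym power2_eq_square algebra_simps)
  then show ?thesis using that by blast
qed

lemma quadratic_form_scaleR:
  assumes "quadratic_form f"
  shows "f (s *\<^sub>R x) = s\<^sup>2 * f x"
proof -
  obtain b where "\<And>s t. f (s *\<^sub>R x + t *\<^sub>R x) = s\<^sup>2 * f x + 2 * s * t * b + t\<^sup>2 * f x"
    using quadratic_form_combination[OF assms] by blast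
  from this[of s 0] show ?thesis by simp
qed

lemma positive_definite_nonneg:
  assumes "quadratic_form f" "positive_definite f"
  shows "0 \<le> f x"
  using assms quadratic_form_scaleR[OF assms(1), of 0 0]
  by (cases "x = 0") (auto simp: positive_definite_def less_imp_le)

lemma attains_value_if_unbounded:
  fixes g :: "real \<Rightarrow> real"
  assumes "continuous_on {t0..} g" "g t0 \<le> a" "filterlim g at_top at_top"
  obtains t where "t0 \<le> t" "g t = a"
proof -
  have "\<forall>\<^sub>F t in at_top. a \<le> g t" using assms(3) by (simp add: filterlim_at_top)
  then obtain N where "\<And>t. N \<le> t \<Longrightarrow> a \<le> g t" by (auto simp: eventually_at_top_linorder)
  then obtain T where T: "a \<le> g T" "t0 \<le> T" by (metis max.cobounded1 max.cobounded2)
  have "continuous_on {t0..T} g" using assms(1) by (rule continuous_on_subset) auto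
  then show ?thesis using IVT'[of g t0 a T] T assms(2) that by auto
qed

text \<open>
  The direction \<open>w\<close> supplies a curve through \<open>z\<close> on which the products \<open>l L\<^sub>i\<close> are constant and
  \<open>f\<close> is unbounded: a line if \<open>l w = 0\<close>, a branch of a hyperbola if neither \<open>l w\<close> nor
  \<open>l z\<close> is zero.
\<close>

lemma raise_definite_form:
  fixes f l :: "real ^ 'n \<Rightarrow> real" and L :: "'i \<Rightarrow> real ^ 'n \<Rightarrow> real"
  assumes qf: "quadratic_form f" and pd: "positive_definite f"
    and H: "subspace H" and l: "linear l" and L: "\<And>i. i \<in> I \<Longrightarrow> linear (L i)"
    and w: "w \<in> H" "w \<noteq> 0" "\<And>i. i \<in> I \<Longrightarrow> L i w = 0"
    and z: "z \<in> H" "f z \<le> a"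
  obtains y where "y \<in> H" "f y = a" "\<And>i. i \<in> I \<Longrightarrow> l y * L i y = l z * L i z"
proof (cases "l w = 0")
  case True
  obtain b where b: "\<And>s t. f (s *\<^sub>R z + t *\<^sub>R w) = s\<^sup>2 * f z + 2 * s * t * b + t\<^sup>2 * f w"
    using quadratic_form_combination[OF qf] by blast
  have g: "f (z + t *\<^sub>R w) = f z + 2 * t * b + t\<^sup>2 * f w" for t
    using b[of 1 t] by simp
  have "0 < f w" using pd w(2) by (simp add: positive_definite_def)
  then have "filterlim (\<lambda>t. f z + 2 * t * b + t\<^sup>2 * f w) at_top at_top"
    by real_asymp
  then obtain t where "f z + 2 * t * b + t\<^sup>2 * f w = a"
    by (rule attains_value_if_unbounded[rotated 2, of _ 0 a])
      (use z(2) in \<open>auto intro!: continuous_intros\<close>)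
  then have "f (z + t *\<^sub>R w) = a" by (simp add: g)
  moreover have "z + t *\<^sub>R w \<in> H"
    using H w(1) z(1) by (simp add: subspace_add subspace_scale)
  moreover have "l (z + t *\<^sub>R w) * L i (z + t *\<^sub>R w) = l z * L i z" if "i \<in> I" for i
    using that True w(3) by (simp add: linear_add linear_scale l L)
  ultimately show ?thesis using that by blast
next
  case False
  show ?thesis
  proof (cases "l z = 0")
    case lz: True
    \<comment> \<open>All products vanish at \<open>z\<close>, and by the choice of \<open>w\<close> they vanish on the line that it spans.\<close>
    have fw: "0 < f w" using pd w(2) by (simp add: positive_definite_def)
    have "0 \<le> a" using positive_definite_nonneg[OF qf pd, of z] z(2) by simp
    then have "f (sqrt (a / f w) *\<^sub>R w) = a"
      using fw by (simp add: quadratic_form_scaleR[OF qf])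
    moreover have "sqrt (a / f w) *\<^sub>R w \<in> H" using H w(1) by (simp add: subspace_scale)
    moreover have "l (c *\<^sub>R w) * L i (c *\<^sub>R w) = l z * L i z" if "i \<in> I" for i c
      using that lz w(3) by (simp add: linear_scale l L)
    ultimately show ?thesis using that by blast
  next
    case lz: False
    define p where "p = (l z / l w) *\<^sub>R w"
    define q where "q = z - p"
    have p: "p \<in> H" "p \<noteq> 0" "l p = l z" "\<And>i. i \<in> I \<Longrightarrow> L i p = 0"
      using H w lz False by (auto simp: p_def subspace_scale linear_scale l L)
    have q: "q \<in> H" "l q = 0" "\<And>i. i \<in> I \<Longrightarrow> L i q = L i z"
      using H z(1) p by (auto simp: q_def subspace_diff linear_diff l L)
    obtain b where b: "\<And>s t. f (s *\<^sub>R p + t *\<^sub>R q) = s\<^sup>2 * f p + 2 * s * t * b + t\<^sup>2 * f q"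
      using quadratic_form_combination[OF qf] by blast
    define g where "g = (\<lambda>t. t\<^sup>2 * f p + 2 * b + (1 / t)\<^sup>2 * f q)"
    have "0 < f p" using pd p(2) by (simp add: positive_definite_def)
    then have lim: "filterlim g at_top at_top"
      unfolding g_def by real_asymp
    have cont: "continuous_on {1..} g"
      unfolding g_def by (auto intro!: continuous_intros)
    have "g 1 \<le> a" using b[of 1 1] z(2) by (simp add: g_def q_def)
    then obtain t where t: "1 \<le> t" "g t = a"
      using attains_value_if_unbounded[OF cont _ lim] by blast
    define y where "y = t *\<^sub>R p + (1 / t) *\<^sub>R q"
    have "f y = a" using b[of t "1 / t"] t by (simp add: y_def g_def)
    moreover have "y \<in> H" using H p(1) q(1) by (simp add: y_def subspace_add subspace_scale)
    moreover have "l y * L i y = l z * L i z" if "i \<in> I" for i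
      using that t(1) p(3,4) q(2,3) by (simp add: y_def linear_add linear_scale l L)
    ultimately show ?thesis using that by blast
  qed
qed

section \<open>Preimages of convex combinations\<close>

text \<open>
  The point is \<open>z = (u l(x) x + v l(y) y) / s\<close> with \<open>s\<^sup>2 = u l(x)\<^sup>2 + v l(y)\<^sup>2\<close>. The bound on \<open>f z\<close>
  is Cauchy--Schwarz, in the form of the identity
  \<open>s\<^sup>2 (u f(x) + v f(y)) - f(u l(x) x + v l(y) y) = u v f(l(y) x - l(x) y)\<close>.
\<close>

lemma exists_below_convex_combination:
  fixes f l :: "real ^ 'n \<Rightarrow> real" and L :: "'i \<Rightarrow> real ^ 'n \<Rightarrow> real"
  assumes qf: "quadratic_form f" and pd: "positive_definite f"
    and H: "subspace H" and l: "linear l" and L: "\<And>i. i \<in> I \<Longrightarrow> linear (L i)"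
    and x: "x \<in> H" and y: "y \<in> H" and uv: "0 \<le> u" "0 \<le> v"
    and pos: "0 < u * (l x)\<^sup>2 + v * (l y)\<^sup>2"
  obtains z where "z \<in> H" "f z \<le> u * f x + v * f y"
    "\<And>i. i \<in> I \<Longrightarrow> l z * L i z = u * (l x * L i x) + v * (l y * L i y)"
proof -
  define s where "s = sqrt (u * (l x)\<^sup>2 + v * (l y)\<^sup>2)"
  have s: "s > 0" "s\<^sup>2 = u * (l x)\<^sup>2 + v * (l y)\<^sup>2"
    using pos by (auto simp: s_def)
  define d where "d = (u * l x) *\<^sub>R x + (v * l y) *\<^sub>R y"
  define z where "z = (1 / s) *\<^sub>R d"
  have "z \<in> H" using H x y by (simp add: z_def d_def subspace_add subspace_scale)
  moreover have "f z \<le> u * f x + v * f y"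
  proof -
    obtain b where b: "\<And>s t. f (s *\<^sub>R x + t *\<^sub>R y) = s\<^sup>2 * f x + 2 * s * t * b + t\<^sup>2 * f y"
      using quadratic_form_combination[OF qf] by blast
    have "s\<^sup>2 * (u * f x + v * f y) - f d = u * v * f (l y *\<^sub>R x + (- l x) *\<^sub>R y)"
      unfolding d_def b s(2) by (simp add: power2_eq_square algebra_simps)
    also have "\<dots> \<ge> 0" using uv positive_definite_nonneg[OF qf pd] by simp
    finally have "f d \<le> s\<^sup>2 * (u * f x + v * f y)" by simp
    then show ?thesis
      using s(1) by (simp add: z_def quadratic_form_scaleR[OF qf] power_divide divide_simps mult.commute)
  qed
  moreover have "l z * L i z = u * (l x * L i x) + v * (l y * L i y)" if "i \<in> I" for i
  proof -
    have "l d = s\<^sup>2" "L i d = u * (l x * L i x) + v * (l y * L i y)"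
      using that s(2) by (simp_all add: d_def linear_add linear_scale l L power2_eq_square)
    then show ?thesis
      using that s(1) by (simp add: z_def linear_scale l L power2_eq_square)
  qed
  ultimately show ?thesis using that by blast
qed

lemma convex_combination_attained:
  fixes f l :: "real ^ 'n \<Rightarrow> real" and L :: "'i \<Rightarrow> real ^ 'n \<Rightarrow> real"
  assumes qf: "quadratic_form f" and pd: "positive_definite f"
    and H: "subspace H" and l: "linear l" and L: "\<And>i. i \<in> I \<Longrightarrow> linear (L i)"
    and I: "finite I" "card I < dim H" and dim: "1 < dim H"
    and x: "x \<in> H" and y: "y \<in> H" and uv: "0 \<le> u" "0 \<le> v"
  obtains z where "z \<in> H" "f z = u * f x + v * f y"
    "\<And>i. i \<in> I \<Longrightarrow> l z * L i z = u * (l x * L i x) + v * (l y * L i y)"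
proof (cases "0 < u * (l x)\<^sup>2 + v * (l y)\<^sup>2")
  case True
  obtain z where z: "z \<in> H" "f z \<le> u * f x + v * f y"
      "\<And>i. i \<in> I \<Longrightarrow> l z * L i z = u * (l x * L i x) + v * (l y * L i y)"
    by (rule exists_below_convex_combination[where I = I and L = L, OF qf pd H l L x y uv True])
      (assumption, rule that)
  obtain w where w: "w \<in> H" "w \<noteq> 0" "\<And>i. i \<in> I \<Longrightarrow> L i w = 0"
    by (rule common_zero_of_functionals[where L = L, OF H I L]) (assumption, rule that)
  obtain z' where "z' \<in> H" "f z' = u * f x + v * f y" "\<And>i. i \<in> I \<Longrightarrow> l z' * L i z' = l z * L i z"
    by (rule raise_definite_form[where I = I and L = L, OF qf pd H l L w z(1,2)])
      (assumption, assumption, rule that)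
  then show ?thesis using that z(3) by auto
next
  case False
  have nonneg: "0 \<le> u * (l x)\<^sup>2" "0 \<le> v * (l y)\<^sup>2" using uv by auto
  then have "u * (l x)\<^sup>2 = 0" "v * (l y)\<^sup>2 = 0" using False by linarith+
  then have zero: "u * l x = 0" "v * l y = 0" by auto
  obtain w where w: "w \<in> H" "w \<noteq> 0" "l w = 0"
    using common_zero_of_functionals[OF H, of "{()}" "\<lambda>_. l"] dim l by auto
  have fw: "0 < f w" using pd w(2) by (simp add: positive_definite_def)
  define a where "a = u * f x + v * f y"
  have "0 \<le> a" using uv positive_definite_nonneg[OF qf pd] by (simp add: a_def)
  then have "f (sqrt (a / f w) *\<^sub>R w) = a" using fw by (simp add: quadratic_form_scaleR[OF qf])
  moreover have "sqrt (a / f w) *\<^sub>R w \<in> H" using H w(1) by (simp add: subspace_scale)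
  moreover have "l (c *\<^sub>R w) * L i (c *\<^sub>R w) = u * (l x * L i x) + v * (l y * L i y)" for i c
  proof -
    have "l (c *\<^sub>R w) = 0" using w(3) by (simp add: linear_scale[OF l])
    moreover have "u * (l x * L i x) = 0" "v * (l y * L i y) = 0" using zero by auto
    ultimately show ?thesis by (simp only: mult_zero_left add_0)
  qed
  ultimately show ?thesis using that unfolding a_def by blast
qed

theorem theorem2p8:
  fixes m :: nat
    and f :: "nat \<Rightarrow> real ^ 'n \<Rightarrow> real"
    and idx :: "'k::finite \<Rightarrow> nat"
  assumes "m \<ge> 1"
    and "CARD('n) > m + 1"
    and "bij_betw idx UNIV {0..m}"
    and "\<And>i. i \<le> m \<Longrightarrow> quadratic_form (f i)"
    and "positive_definite (f 0)"
    and "\<exists>l :: real ^ 'n \<Rightarrow> real. linear l \<and>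
           (\<forall>i\<in>{1..m}. \<exists>l' :: real ^ 'n \<Rightarrow> real. linear l' \<and> (\<forall>x. f i x = l x * l' x))"
  shows "hidden_hyperplane_convex (\<lambda>x. (\<chi> j. f (idx j) x) :: real ^ 'k)"
proof -
  let ?\<phi> = "\<lambda>x. (\<chi> j. f (idx j) x) :: real ^ 'k"
  have idx: "idx j \<le> m" for j
    using assms(3) by (auto simp: bij_betw_def)
  obtain l L where l: "linear l" and L: "\<And>i. i \<in> {1..m} \<Longrightarrow> linear (L i)"
      and fL: "\<And>i x. i \<in> {1..m} \<Longrightarrow> f i x = l x * L i x"
    using assms(6) by metis
  have "convex (?\<phi> ` H)" if "linear_hyperplane H" for H
  proof (rule convexI)
    fix a b and u v :: real
    assume uv: "0 \<le> u" "0 \<le> v" and ab: "a \<in> ?\<phi> ` H" "b \<in> ?\<phi> ` H"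
    obtain x y where xy: "x \<in> H" "a = ?\<phi> x" "y \<in> H" "b = ?\<phi> y" using ab by auto
    have H: "subspace H" and "dim H = CARD('n) - 1"
      using that by (auto simp: linear_hyperplane_def)
    then have dim: "card {1..m} < dim H" "1 < dim H" using assms(1,2) by auto
    obtain z where z: "z \<in> H" "f 0 z = u * f 0 x + v * f 0 y"
        "\<And>i. i \<in> {1..m} \<Longrightarrow> l z * L i z = u * (l x * L i x) + v * (l y * L i y)"
      by (rule convex_combination_attained[OF assms(4)[of 0] assms(5) H l L
            finite_atLeastAtMost dim xy(1,3) uv]) auto
    have "f i z = u * f i x + v * f i y" if "i \<le> m" for i
      using that z(2,3) fL by (cases "i = 0") auto
    then have "?\<phi> z = u *\<^sub>R a + v *\<^sub>R b"
      using idx by (simp add: vec_eq_iff xy)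
    then show "u *\<^sub>R a + v *\<^sub>R b \<in> ?\<phi> ` H" using z(1) by (metis imageI)
  qed
  moreover have "quadratic_map ?\<phi>" using assms(4) idx by (simp add: quadratic_map_def)
  ultimately show ?thesis by (simp add: hidden_hyperplane_convex_def)
qed

end
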